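(* Let $n_0\in\mathbb{N}$ and let $x_1,\dots,x_{n_0},y$ be distinct commuting indeterminates over $\mathbb{C}$. Let $\Phi:\mathcal{S}_{x_1,\dots,x_{n_0}}\to\mathcal{S}_{x_1,\dots,x_{n_0},y}$ be the algebra-monomorphism determined by $$\Phi\left(\varepsilon_k^{x_1,\dots,x_{n_0}}\right)=\varepsilon_k^{x_1,\dots,x_{n_0}}+\varepsilon_{k-1}^{x_1,\dots,x_{n_0}}\,y,\qquad k=1,\dots,n_0.$$ Then there is an algebra isomorphism $$\mathcal{S}_{x_1,\dots,x_{n_0},y}\;\cong\;\Phi\left(\mathcal{S}_{x_1,\dots,x_{n_0}}\right)\oplus\mathbb{C}\left[\left\{\varepsilon_{n_0}^{x_1,\dots,x_{n_0}}\,\varepsilon_1^{y}\right\}\right],$$ where $\oplus$ means the (pure-algebraic) direct product of algebras.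
   Context: For distinct commuting indeterminates $z_1,\dots,z_m$, $\mathcal{S}_{z_1,\dots,z_m}$ is the subalgebra of $\mathbb{C}[z_1,\dots,z_m]$ consisting of symmetric polynomials. $\varepsilon_k^{z_1,\dots,z_m}$ is the $k$-th elementary symmetric polynomial in $z_1,\dots,z_m$ for $1\le k\le m$, with $\varepsilon_0^{z_1,\dots,z_m}=1$; in particular $\varepsilon_1^{y}=y$. By the fundamental theorem of symmetric functions, $\mathcal{S}_{x_1,\dots,x_{n_0}}$ is generated by $\varepsilon_1^{x_1,\dots,x_{n_0}},\dots,\varepsilon_{n_0}^{x_1,\dots,x_{n_0}}$; $\Phi$ is the linear multiplicative map fixing constants and extending the given values on these generators, i.e. $\Phi$ sends a polynomial expression $t_0+\sum t_{i_1,\dots,i_k}\prod_{l}\varepsilon_{i_l}^{x_1,\dots,x_{n_0}}$ (with coefficients in $\mathbb{C}$) to $t_0+\sum t_{i_1,\dots,i_k}\prod_{l}\Phi(\varepsilon_{i_l}^{x_1,\dots,x_{n_0}})$. For a set $X$ of polynomials, $\mathbb{C}[X]$ denotes the algebra generated by $X$.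
   Formalization: The "direct product of algebras" ⊕ is formalized as the algebraic tensor product over C; with the Cartesian product the claim is false for every n_0, since the left side has no zero divisors while (1,0)(0,1)=0 on the right. *)

theory Defs
  imports
    Complex_Main
    "HOL-Library.Poly_Mapping"
    "HOL-Combinatorics.Permutations"
    "HOL-Algebra.QuotRing"
    "HOL-Algebra.Module"
    "HOL-Algebra.Chinese_Remainder"
begin

section \<open>Polynomials over the complex numbers\<close>

text \<open>
  A polynomial maps monomials to coefficients, and a monomial maps indeterminates (the elements
  of \<^typ>\<open>'v\<close>) to exponents, both with finite support. The ring operations are those of
  \<^theory>\<open>HOL-Library.Poly_Mapping\<close>.
\<close>

type_synonym 'v cpoly = "('v \<Rightarrow>\<^sub>0 nat) \<Rightarrow>\<^sub>0 complex"

definition const_poly :: "complex \<Rightarrow> 'v cpoly" where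
  "const_poly c = Poly_Mapping.single 0 c"

definition indet :: "'v \<Rightarrow> 'v cpoly" where
  "indet v = Poly_Mapping.single (Poly_Mapping.single v 1) 1"

definition polys_in :: "'v set \<Rightarrow> 'v cpoly set" where
  "polys_in V = {p. \<forall>m\<in>Poly_Mapping.keys p. Poly_Mapping.keys m \<subseteq> V}"

text \<open>
  A polynomial is symmetric in \<^term>\<open>V\<close> if permuting the indeterminates does not change it; in
  terms of coefficients, monomials that differ by a permutation have the same coefficient
  (\<^term>\<open>Poly_Mapping.map_key \<pi> m\<close> is \<^term>\<open>m\<close> with the exponent of \<^term>\<open>\<pi> v\<close> moved to
  \<^term>\<open>v\<close>).
\<close>

definition sym_polys :: "'v set \<Rightarrow> 'v cpoly set" where
  "sym_polys V = {p \<in> polys_in V. \<forall>\<pi>. \<pi> permutes V \<longrightarrow>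
     (\<forall>m. Poly_Mapping.lookup p (Poly_Mapping.map_key \<pi> m) = Poly_Mapping.lookup p m)}"

definition esym :: "'v set \<Rightarrow> nat \<Rightarrow> 'v cpoly" where
  "esym V k = (\<Sum>I | I \<subseteq> V \<and> card I = k. \<Prod>v\<in>I. indet v)"

inductive_set generated_algebra :: "'v cpoly set \<Rightarrow> 'v cpoly set" for X where
  const: "const_poly c \<in> generated_algebra X"
| base: "p \<in> X \<Longrightarrow> p \<in> generated_algebra X"
| add: "p \<in> generated_algebra X \<Longrightarrow> q \<in> generated_algebra X \<Longrightarrow> p + q \<in> generated_algebra X"
| mult: "p \<in> generated_algebra X \<Longrightarrow> q \<in> generated_algebra X \<Longrightarrow> p * q \<in> generated_algebra X"


section \<open>Complex algebras\<close>

text \<open>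
  Algebras are \<^type>\<open>module\<close> records (which carry a ring structure together with a scalar
  multiplication) with scalars in \<^typ>\<open>complex\<close>.
\<close>

definition poly_algebra :: "'v cpoly set \<Rightarrow> (complex, 'v cpoly) module" where
  "poly_algebra A = \<lparr>carrier = A, mult = (*), one = 1, zero = 0, add = (+),
     smult = (\<lambda>c p. const_poly c * p)\<rparr>"

definition sym_algebra :: "'v set \<Rightarrow> (complex, 'v cpoly) module" where
  "sym_algebra V = poly_algebra (sym_polys V)"

definition algebra_hom ::
  "(complex, 'a, 'm) module_scheme \<Rightarrow> (complex, 'b, 'n) module_scheme \<Rightarrow> ('a \<Rightarrow> 'b) set" where
  "algebra_hom A B = {h \<in> ring_hom A B. \<forall>c. \<forall>a\<in>carrier A. h (c \<odot>\<^bsub>A\<^esub> a) = c \<odot>\<^bsub>B\<^esub> h a}"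

definition algebra_mono ::
  "(complex, 'a, 'm) module_scheme \<Rightarrow> (complex, 'b, 'n) module_scheme \<Rightarrow> ('a \<Rightarrow> 'b) set" where
  "algebra_mono A B = {h \<in> algebra_hom A B. inj_on h (carrier A)}"

definition algebra_iso ::
  "(complex, 'a, 'm) module_scheme \<Rightarrow> (complex, 'b, 'n) module_scheme \<Rightarrow> ('a \<Rightarrow> 'b) set" where
  "algebra_iso A B = {h \<in> algebra_hom A B. bij_betw h (carrier A) (carrier B)}"


section \<open>The direct product of algebras\<close>

text \<open>
  ``Direct product of algebras'' is taken in the classical sense of Wedderburn and Albert, that
  is, as the algebraic tensor product over the scalars, which is also the direct sum (coproduct)
  in the category of commutative unital algebras. The Cartesian product cannot be meant: the
  ring of symmetric polynomials has no zero divisors, so it is not isomorphic to a Cartesian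
  product of nonzero rings (\<open>domain_not_cartesian\<close> below).

  The construction is the usual one: the vector space with basis \<open>A \<times> B\<close>, with the
  multiplication that is bilinear and componentwise on the basis, modulo the linear span of the
  bilinearity relations.
\<close>

definition pair_algebra ::
  "(complex, 'a, 'm) module_scheme \<Rightarrow> (complex, 'b, 'n) module_scheme
     \<Rightarrow> (complex, ('a \<times> 'b) \<Rightarrow>\<^sub>0 complex) module" where
  "pair_algebra A B =
     \<lparr>carrier = {f. Poly_Mapping.keys f \<subseteq> carrier A \<times> carrier B},
      mult = (\<lambda>f g. \<Sum>p\<in>Poly_Mapping.keys f. \<Sum>q\<in>Poly_Mapping.keys g.
        Poly_Mapping.single (fst p \<otimes>\<^bsub>A\<^esub> fst q, snd p \<otimes>\<^bsub>B\<^esub> snd q)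
          (Poly_Mapping.lookup f p * Poly_Mapping.lookup g q)),
      one = Poly_Mapping.single (\<one>\<^bsub>A\<^esub>, \<one>\<^bsub>B\<^esub>) 1,
      zero = 0,
      add = (+),
      smult = (\<lambda>c f. Poly_Mapping.map ((*) c) f)\<rparr>"

inductive_set bilinear_relations ::
  "(complex, 'a, 'm) module_scheme \<Rightarrow> (complex, 'b, 'n) module_scheme
     \<Rightarrow> (('a \<times> 'b) \<Rightarrow>\<^sub>0 complex) set" for A B where
  zero: "0 \<in> bilinear_relations A B"
| plus: "f \<in> bilinear_relations A B \<Longrightarrow> g \<in> bilinear_relations A B
    \<Longrightarrow> f + g \<in> bilinear_relations A B"
| scale: "f \<in> bilinear_relations A B \<Longrightarrow> Poly_Mapping.map ((*) c) f \<in> bilinear_relations A B"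
| add_left: "a \<in> carrier A \<Longrightarrow> a' \<in> carrier A \<Longrightarrow> b \<in> carrier B
    \<Longrightarrow> Poly_Mapping.single (a \<oplus>\<^bsub>A\<^esub> a', b) 1 - Poly_Mapping.single (a, b) 1
          - Poly_Mapping.single (a', b) 1 \<in> bilinear_relations A B"
| add_right: "a \<in> carrier A \<Longrightarrow> b \<in> carrier B \<Longrightarrow> b' \<in> carrier B
    \<Longrightarrow> Poly_Mapping.single (a, b \<oplus>\<^bsub>B\<^esub> b') 1 - Poly_Mapping.single (a, b) 1
          - Poly_Mapping.single (a, b') 1 \<in> bilinear_relations A B"
| smult_left: "a \<in> carrier A \<Longrightarrow> b \<in> carrier B
    \<Longrightarrow> Poly_Mapping.single (c \<odot>\<^bsub>A\<^esub> a, b) 1 - Poly_Mapping.single (a, b) c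
          \<in> bilinear_relations A B"
| smult_right: "a \<in> carrier A \<Longrightarrow> b \<in> carrier B
    \<Longrightarrow> Poly_Mapping.single (a, c \<odot>\<^bsub>B\<^esub> b) 1 - Poly_Mapping.single (a, b) c
          \<in> bilinear_relations A B"

definition direct_product_algebra ::
  "(complex, 'a, 'm) module_scheme \<Rightarrow> (complex, 'b, 'n) module_scheme
     \<Rightarrow> (complex, (('a \<times> 'b) \<Rightarrow>\<^sub>0 complex) set) module" where
  "direct_product_algebra A B =
     ring.extend (pair_algebra A B Quot bilinear_relations A B)
       \<lparr>smult = (\<lambda>c F. \<Union>f\<in>F. bilinear_relations A B +>\<^bsub>pair_algebra A B\<^esub>
                               (c \<odot>\<^bsub>pair_algebra A B\<^esub> f))\<rparr>"

lemma domain_not_cartesian: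
  assumes R: "domain R" and A: "ring A" "\<one>\<^bsub>A\<^esub> \<noteq> \<zero>\<^bsub>A\<^esub>" and B: "ring B" "\<one>\<^bsub>B\<^esub> \<noteq> \<zero>\<^bsub>B\<^esub>"
  shows "ring_iso R (RDirProd A B) = {}"
proof (rule ccontr)
  assume "ring_iso R (RDirProd A B) \<noteq> {}"
  then obtain h where h: "h \<in> ring_hom R (RDirProd A B)"
    and bij: "bij_betw h (carrier R) (carrier (RDirProd A B))"
    by (auto simp: ring_iso_def)
  interpret R: domain R by (rule R)
  interpret A: ring A by (rule A)
  interpret B: ring B by (rule B)
  interpret P: ring "RDirProd A B" by (rule RDirProd_ring[OF A(1) B(1)])
  interpret h: ring_hom_ring R "RDirProd A B" h
    by (rule ring_hom_ringI2[OF R.ring_axioms P.ring_axioms h])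
  have zero: "\<zero>\<^bsub>RDirProd A B\<^esub> = (\<zero>\<^bsub>A\<^esub>, \<zero>\<^bsub>B\<^esub>)"
    by (simp add: RDirProd_def monoid.defs)
  have carr: "carrier (RDirProd A B) = carrier A \<times> carrier B"
    by (rule RDirProd_carrier)
  obtain p where p: "p \<in> carrier R" "h p = (\<one>\<^bsub>A\<^esub>, \<zero>\<^bsub>B\<^esub>)"
    using bij carr unfolding bij_betw_def by (metis A.one_closed B.zero_closed SigmaI imageE)
  obtain q where q: "q \<in> carrier R" "h q = (\<zero>\<^bsub>A\<^esub>, \<one>\<^bsub>B\<^esub>)"
    using bij carr unfolding bij_betw_def by (metis A.zero_closed B.one_closed SigmaI imageE)
  have "h (p \<otimes>\<^bsub>R\<^esub> q) = h \<zero>\<^bsub>R\<^esub>"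
    using p q by (simp add: zero) (simp add: RDirProd_def DirProd_def monoid.defs)
  then have "p \<otimes>\<^bsub>R\<^esub> q = \<zero>\<^bsub>R\<^esub>"
    using bij p q by (meson R.m_closed R.zero_closed bij_betw_imp_inj_on inj_onD)
  then have "p = \<zero>\<^bsub>R\<^esub> \<or> q = \<zero>\<^bsub>R\<^esub>"
    using p q R.integral by blast
  then show False
    using p q A(2) B(2) zero h.hom_zero by auto
qed

end

(* Phi raises the elementary symmetric polynomials of x_1, ..., x_n to those of x_1, ..., x_n, y, and
   the second factor is generated by the remaining one, e = x_1 ... x_n y. So the isomorphism is the
   inverse of the multiplication map a (x) b |-> a b, and what has to be shown is that every symmetric
   polynomial in x_1, ..., x_n, y is a unique polynomial in e with coefficients in the image of Phi.
   Existence is the generation half of the fundamental theorem. For uniqueness, setting y = 0 kills e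
   and inverts Phi on its image; so in a relation sum a_i e^i = 0 the constant coefficient vanishes,
   one cancels e and repeats. *)

theory Submission
  imports Defs "HOL-Computational_Algebra.Polynomial"
begin

section \<open>Linear maps on finitely supported functions\<close>

text \<open>As the product algebra is a concrete quotient of the free vector space on pairs,
  bijectivity of multiplication is a statement about formal combinations: its kernel must be exactly
  the span of the bilinearity relations. The hard inclusion rests on a normal form. The right factor
  consists of polynomials in \<open>e\<close> with scalar coefficients; moving these scalars to the
  left makes every combination congruent to a sum of pairs \<open>(a_i, e^i)\<close>, and uniqueness
  forces all \<open>a_i\<close> to vanish. The cosets are therefore the fibres of multiplication,
  and sending \<open>p\<close> to its fibre avoids any choice of preimages.

  Two steps use that the product of all variables is a single monomial. Multiplication by it only
  translates exponents, so it can be cancelled; and a symmetric polynomial vanishing at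
  \<open>y = 0\<close> is divisible by it, which drives the proof of generation.\<close>

lemma const_poly_0 [simp]: "const_poly 0 = 0"
  and const_poly_1 [simp]: "const_poly 1 = 1"
  by (simp_all add: const_poly_def)

lemma const_poly_add: "const_poly (a + b) = const_poly a + const_poly b"
  by (simp add: const_poly_def single_add)

lemma const_poly_mult: "const_poly (a * b) = const_poly a * const_poly b"
  by (simp add: const_poly_def mult_single)

lemma lookup_const_poly_mult [simp]:
  "Poly_Mapping.lookup (const_poly c * p) m = c * Poly_Mapping.lookup p m"
  unfolding const_poly_def mult_map_scale_conv_mult [symmetric]
  by (simp add: map.rep_eq when_def)

lemma sum_single_eq: "(\<Sum>k\<in>Poly_Mapping.keys f. Poly_Mapping.single k (Poly_Mapping.lookup f k)) = f"
  by (rule poly_mapping_eqI)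
    (simp add: lookup_sum lookup_single when_def in_keys_iff)

text \<open>Multiplying by a monomial translates exponents. Cancelling the product of all variables,
  dividing by it and counting degrees all reduce to this.\<close>

lemma lookup_mult_single:
  fixes m :: "'v \<Rightarrow>\<^sub>0 nat" and p :: "'v cpoly"
  shows "Poly_Mapping.lookup (Poly_Mapping.single m 1 * p) (m + k) = Poly_Mapping.lookup p k"
proof -
  have "Poly_Mapping.single m 1 * p =
      (\<Sum>i\<in>Poly_Mapping.keys p. Poly_Mapping.single (m + i) (Poly_Mapping.lookup p i))"
    by (subst sum_single_eq [of p, symmetric]) (simp add: sum_distrib_left mult_single)
  then show ?thesis
    by (simp add: lookup_sum lookup_single when_def in_keys_iff)
qed

text \<open>The index type is left general because the same extension serves for maps on monomials
  (permuting variables, setting one to zero) and for the multiplication map on pairs.\<close>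

definition lin_ext :: "('k \<Rightarrow> 'v cpoly) \<Rightarrow> ('k \<Rightarrow>\<^sub>0 complex) \<Rightarrow> 'v cpoly" where
  "lin_ext F f = (\<Sum>k\<in>Poly_Mapping.keys f. const_poly (Poly_Mapping.lookup f k) * F k)"

text \<open>Supports may shrink under addition or scaling, so linearity is checked over a common
  finite superset.\<close>

lemma lin_ext_superset:
  assumes "finite K" "Poly_Mapping.keys f \<subseteq> K"
  shows "lin_ext F f = (\<Sum>k\<in>K. const_poly (Poly_Mapping.lookup f k) * F k)"
  unfolding lin_ext_def
  by (rule sum.mono_neutral_left) (use assms in \<open>auto simp: in_keys_iff\<close>)

lemma lin_ext_add: "lin_ext F (f + g) = lin_ext F f + lin_ext F g"
proof -
  let ?K = "Poly_Mapping.keys f \<union> Poly_Mapping.keys g"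
  have "lin_ext F h = (\<Sum>k\<in>?K. const_poly (Poly_Mapping.lookup h k) * F k)" if "h \<in> {f, g, f + g}" for h
    by (rule lin_ext_superset) (use that keys_add [of f g] in auto)
  then show ?thesis
    by (simp add: lookup_add const_poly_add distrib_right sum.distrib)
qed

lemma lin_ext_0 [simp]: "lin_ext F 0 = 0"
  by (simp add: lin_ext_def)

lemma lin_ext_single [simp]: "lin_ext F (Poly_Mapping.single k c) = const_poly c * F k"
  by (cases "c = 0") (simp_all add: lin_ext_def)

lemma lin_ext_diff: "lin_ext F (f - g) = lin_ext F f - lin_ext F g"
  using lin_ext_add [of F "f - g" g] by simp

lemma lin_ext_sum: "lin_ext F (sum f A) = (\<Sum>x\<in>A. lin_ext F (f x))"
  by (induction A rule: infinite_finite_induct) (simp_all add: lin_ext_add)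

lemma lookup_map_mult [simp]:
  "Poly_Mapping.lookup (Poly_Mapping.map ((*) c) f) k = c * Poly_Mapping.lookup f k" for c :: complex
  by (simp add: map.rep_eq when_def)

lemma lin_ext_scale: "lin_ext F (Poly_Mapping.map ((*) c) f) = const_poly c * lin_ext F f"
proof -
  have "lin_ext F (Poly_Mapping.map ((*) c) f)
      = (\<Sum>k\<in>Poly_Mapping.keys f. const_poly (Poly_Mapping.lookup (Poly_Mapping.map ((*) c) f) k) * F k)"
    by (rule lin_ext_superset) (auto simp: in_keys_iff)
  also have "\<dots> = const_poly c * lin_ext F f"
    by (simp add: lin_ext_def sum_distrib_left const_poly_mult mult.assoc)
  finally show ?thesis .
qed

text \<open>The universal property of the monoid algebra: multiplicativity on monomials
  suffices.\<close>

lemma lin_ext_mult: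
  fixes f g :: "'v cpoly"
  assumes "\<And>m n. F (m + n) = F m * F n"
  shows "lin_ext F (f * g) = lin_ext F f * lin_ext F g"
proof -
  have "f * g = (\<Sum>m\<in>Poly_Mapping.keys f. \<Sum>n\<in>Poly_Mapping.keys g.
      Poly_Mapping.single (m + n) (Poly_Mapping.lookup f m * Poly_Mapping.lookup g n))"
    by (subst sum_single_eq [of f, symmetric], subst sum_single_eq [of g, symmetric])
      (simp add: sum_product mult_single)
  then show ?thesis
    by (simp add: lin_ext_sum assms lin_ext_def [of F f] lin_ext_def [of F g] sum_product
        const_poly_mult mult.assoc mult.left_commute)
qed

lemma lin_ext_prod:
  fixes f :: "'a \<Rightarrow> 'v cpoly"
  assumes "\<And>m n. F (m + n) = F m * F n" "F 0 = 1"
  shows "lin_ext F (prod f A) = (\<Prod>x\<in>A. lin_ext F (f x))"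
proof -
  have [simp]: "lin_ext F 1 = 1"
    using lin_ext_single [of F 0 1] assms(2) by simp
  show ?thesis
    by (induction A rule: infinite_finite_induct) (simp_all add: lin_ext_mult [OF assms(1)])
qed

section \<open>Symmetric polynomials\<close>

lemma polys_in_const [simp]: "const_poly c \<in> polys_in V"
  by (auto simp: polys_in_def const_poly_def)

lemma polys_in_add: "p \<in> polys_in V \<Longrightarrow> q \<in> polys_in V \<Longrightarrow> p + q \<in> polys_in V"
  using keys_add [of p q] by (auto simp: polys_in_def)

lemma polys_in_mult:
  assumes "p \<in> polys_in V" "q \<in> polys_in V" shows "p * q \<in> polys_in V"
  unfolding polys_in_def
proof (intro CollectI ballI)
  fix m assume "m \<in> Poly_Mapping.keys (p * q)"
  then obtain a b where "a \<in> Poly_Mapping.keys p" "b \<in> Poly_Mapping.keys q" "m = a + b"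
    using keys_mult [of p q] by auto
  then show "Poly_Mapping.keys m \<subseteq> V"
    using assms keys_add [of a b] unfolding polys_in_def by blast
qed

lemma polys_in_diff: "p \<in> polys_in V \<Longrightarrow> q \<in> polys_in V \<Longrightarrow> p - q \<in> polys_in V"
  using keys_diff [of p q] by (auto simp: polys_in_def)

lemma polys_in_sum: "(\<And>i. i \<in> I \<Longrightarrow> f i \<in> polys_in V) \<Longrightarrow> sum f I \<in> polys_in V"
  using polys_in_const [of 0]
  by (induction I rule: infinite_finite_induct) (auto intro: polys_in_add)

lemma polys_in_prod: "(\<And>i. i \<in> I \<Longrightarrow> f i \<in> polys_in V) \<Longrightarrow> prod f I \<in> polys_in V"
  using polys_in_const [of 1]
  by (induction I rule: infinite_finite_induct) (auto intro: polys_in_mult)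

lemma polys_in_indet: "v \<in> V \<Longrightarrow> indet v \<in> polys_in V"
  by (auto simp: polys_in_def indet_def)

lemma polys_in_esym: "esym V k \<in> polys_in V"
  unfolding esym_def by (intro polys_in_sum polys_in_prod polys_in_indet) auto

lemma lookup_map_key: "inj \<pi> \<Longrightarrow> Poly_Mapping.lookup (Poly_Mapping.map_key \<pi> m) v = Poly_Mapping.lookup m (\<pi> v)"
  by (simp add: map_key.rep_eq)

definition permute_vars :: "('v \<Rightarrow> 'v) \<Rightarrow> 'v cpoly \<Rightarrow> 'v cpoly" where
  "permute_vars \<pi> = lin_ext (\<lambda>m. Poly_Mapping.single (Poly_Mapping.map_key \<pi> m) 1)"

text \<open>A bijection of the variables acts injectively on monomials, so a single term of the sum
  survives.\<close>

lemma lookup_permute_vars: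
  assumes "bij \<pi>"
  shows "Poly_Mapping.lookup (permute_vars \<pi> p) (Poly_Mapping.map_key \<pi> m) = Poly_Mapping.lookup p m"
proof -
  have inj: "inj \<pi>" using assms by (rule bij_is_inj)
  have eq: "Poly_Mapping.map_key \<pi> k = Poly_Mapping.map_key \<pi> m \<longleftrightarrow> k = m" for k
  proof
    assume "Poly_Mapping.map_key \<pi> k = Poly_Mapping.map_key \<pi> m"
    then have "Poly_Mapping.lookup k (\<pi> v) = Poly_Mapping.lookup m (\<pi> v)" for v
      by (metis lookup_map_key [OF inj])
    then show "k = m"
      using assms by (metis bij_pointE poly_mapping_eqI)
  qed simp
  show ?thesis
    by (simp add: permute_vars_def lin_ext_def lookup_sum lookup_single when_def eq in_keys_iff if_distrib sum.If_cases Int_def cong: if_cong)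
qed

text \<open>Replaces the condition on coefficients by invariance under a linear multiplicative map;
  the closure properties then come from those of \<open>lin_ext\<close>.\<close>

lemma sym_polys_iff:
  fixes p :: "'v cpoly"
  shows "p \<in> sym_polys V \<longleftrightarrow> p \<in> polys_in V \<and> (\<forall>\<pi>. \<pi> permutes V \<longrightarrow> permute_vars \<pi> p = p)"
proof -
  have "(\<forall>m. Poly_Mapping.lookup p (Poly_Mapping.map_key \<pi> m) = Poly_Mapping.lookup p m)
      \<longleftrightarrow> permute_vars \<pi> p = p" if "\<pi> permutes V" for \<pi>
  proof
    assume *: "\<forall>m. Poly_Mapping.lookup p (Poly_Mapping.map_key \<pi> m) = Poly_Mapping.lookup p m"
    show "permute_vars \<pi> p = p"
    proof (rule poly_mapping_eqI)
      fix k :: "'v \<Rightarrow>\<^sub>0 nat"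
      \<comment> \<open>Every monomial is a permuted one, so comparing coefficients at permuted
        monomials is enough.\<close>
      have "k = Poly_Mapping.map_key \<pi> (Poly_Mapping.map_key (inv_into UNIV \<pi>) k)"
        using that
        by (intro poly_mapping_eqI) (simp add: lookup_map_key permutes_inj permutes_inj [OF permutes_inv [OF that]] permutes_inverses)
      then show "Poly_Mapping.lookup (permute_vars \<pi> p) k = Poly_Mapping.lookup p k"
        by (metis * lookup_permute_vars [OF permutes_bij [OF that]])
    qed
  next
    assume "permute_vars \<pi> p = p"
    then show "\<forall>m. Poly_Mapping.lookup p (Poly_Mapping.map_key \<pi> m) = Poly_Mapping.lookup p m"
      by (metis lookup_permute_vars [OF permutes_bij [OF that]])
  qed
  then show ?thesis
    by (auto simp: sym_polys_def)
qed

lemma permute_vars_mult: "inj \<pi> \<Longrightarrow> permute_vars \<pi> (p * q) = permute_vars \<pi> p * permute_vars \<pi> q"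
  unfolding permute_vars_def by (rule lin_ext_mult) (simp add: map_key_plus mult_single)

lemma permute_vars_const: "inj \<pi> \<Longrightarrow> permute_vars \<pi> (const_poly c) = const_poly c"
  by (simp add: permute_vars_def const_poly_def mult_single)

lemma sym_polys_const [simp]: "const_poly c \<in> sym_polys V"
  by (simp add: sym_polys_iff permute_vars_const permutes_inj)

lemma sym_polys_add: "p \<in> sym_polys V \<Longrightarrow> q \<in> sym_polys V \<Longrightarrow> p + q \<in> sym_polys V"
  by (simp add: sym_polys_iff polys_in_add permute_vars_def lin_ext_add)

lemma sym_polys_diff: "p \<in> sym_polys V \<Longrightarrow> q \<in> sym_polys V \<Longrightarrow> p - q \<in> sym_polys V"
  by (simp add: sym_polys_iff polys_in_diff permute_vars_def lin_ext_diff)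

lemma sym_polys_mult: "p \<in> sym_polys V \<Longrightarrow> q \<in> sym_polys V \<Longrightarrow> p * q \<in> sym_polys V"
  by (simp add: sym_polys_iff polys_in_mult permute_vars_mult permutes_inj)

lemma sym_polys_1 [simp]: "1 \<in> sym_polys V"
  using sym_polys_const [of 1] by simp

lemma sym_polys_power: "p \<in> sym_polys V \<Longrightarrow> p ^ i \<in> sym_polys V"
  by (induction i) (auto intro: sym_polys_mult)

text \<open>The inverse appears because \<open>map_key\<close> pulls exponents back along
  \<open>\<pi>\<close>.\<close>

lemma permute_vars_indet:
  assumes "bij \<pi>"
  shows "permute_vars \<pi> (indet v) = indet (inv_into UNIV \<pi> v)"
proof -
  have "Poly_Mapping.map_key \<pi> (Poly_Mapping.single v (1::nat)) = Poly_Mapping.single (inv_into UNIV \<pi> v) 1"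
    using map_key_single [OF bij_is_inj [OF assms], of "inv_into UNIV \<pi> v" 1] bij_inv_eq_iff [OF assms] by metis
  then show ?thesis
    by (simp add: permute_vars_def indet_def)
qed

text \<open>Permuting the variables only permutes the \<open>k\<close>-element subsets over which
  the sum runs.\<close>

lemma sym_polys_esym: "esym V k \<in> sym_polys V"
  unfolding sym_polys_iff
proof (intro conjI allI impI polys_in_esym)
  fix \<pi> assume \<pi>: "\<pi> permutes V"
  let ?S = "{I. I \<subseteq> V \<and> card I = k}"
  have bij: "bij \<pi>" and inj: "inj \<pi>" and inj': "inj (inv_into UNIV \<pi>)"
    using \<pi> permutes_inv [OF \<pi>] by (auto dest: permutes_bij permutes_inj)
  have "permute_vars \<pi> (\<Prod>v\<in>I. indet v) = (\<Prod>v\<in>inv_into UNIV \<pi> ` I. indet v)" for I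
  proof -
    have "permute_vars \<pi> (\<Prod>v\<in>I. indet v) = (\<Prod>v\<in>I. indet (inv_into UNIV \<pi> v))"
      unfolding permute_vars_indet [OF bij, symmetric] unfolding permute_vars_def
      by (rule lin_ext_prod) (simp_all add: map_key_plus inj mult_single)
    then show ?thesis
      by (simp add: prod.reindex inj_on_subset [OF inj'])
  qed
  then have "permute_vars \<pi> (esym V k) = (\<Sum>I\<in>?S. \<Prod>v\<in>inv_into UNIV \<pi> ` I. indet v)"
    by (simp add: esym_def permute_vars_def lin_ext_sum)
  also have "\<dots> = (\<Sum>I\<in>?S. \<Prod>v\<in>I. indet v)"
  proof (rule sum.reindex_bij_witness [where i = "image \<pi>" and j = "image (inv_into UNIV \<pi>)"])
    fix I assume "I \<in> ?S"
    then show "inv_into UNIV \<pi> ` I \<in> ?S" "\<pi> ` I \<in> ?S"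
      using permutes_image [OF \<pi>] permutes_image [OF permutes_inv [OF \<pi>]]
      by (simp_all add: card_image inj_on_subset [OF inj] inj_on_subset [OF inj']) blast+
    show "\<pi> ` inv_into UNIV \<pi> ` I = I" "inv_into UNIV \<pi> ` \<pi> ` I = I"
      using permutes_inverses [OF \<pi>] by (auto simp: image_image)
  qed simp
  finally show "permute_vars \<pi> (esym V k) = esym V k"
    by (simp add: esym_def)
qed

section \<open>Setting a variable to zero\<close>

definition kill_var :: "'v \<Rightarrow> 'v cpoly \<Rightarrow> 'v cpoly" where
  "kill_var y = lin_ext (\<lambda>m. if Poly_Mapping.lookup m y = 0 then Poly_Mapping.single m 1 else 0)"

lemma lookup_kill_var:
  "Poly_Mapping.lookup (kill_var y p) m = (if Poly_Mapping.lookup m y = 0 then Poly_Mapping.lookup p m else 0)"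
proof -
  have "Poly_Mapping.lookup (const_poly c * (if Poly_Mapping.lookup k y = 0 then Poly_Mapping.single k 1 else 0)) m
      = (if k = m then if Poly_Mapping.lookup m y = 0 then c else 0 else 0)" for k c
    by (simp add: lookup_single when_def)
  then show ?thesis
    unfolding kill_var_def lin_ext_def lookup_sum by (simp add: in_keys_iff)
qed

text \<open>Exponents are natural numbers: the exponent of \<open>y\<close> in \<open>m + n\<close>
  is zero only if it is zero in both.\<close>

lemma kill_var_mult: "kill_var y (p * q) = kill_var y p * kill_var y q"
  unfolding kill_var_def by (rule lin_ext_mult) (simp add: lookup_add mult_single)

lemma kill_var_add: "kill_var y (p + q) = kill_var y p + kill_var y q"
  by (simp add: kill_var_def lin_ext_add)

lemma kill_var_diff: "kill_var y (p - q) = kill_var y p - kill_var y q"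
  by (simp add: kill_var_def lin_ext_diff)

lemma kill_var_0 [simp]: "kill_var y 0 = 0"
  by (simp add: kill_var_def)

lemma kill_var_indet [simp]: "kill_var y (indet y) = 0"
  by (simp add: kill_var_def indet_def)

lemma kill_var_id:
  assumes "p \<in> polys_in V" "y \<notin> V"
  shows "kill_var y p = p"
proof (rule poly_mapping_eqI)
  fix m
  have "Poly_Mapping.lookup m y = 0" if "m \<in> Poly_Mapping.keys p"
    using assms that not_in_keys_iff_lookup_eq_zero [of y m] by (auto simp: polys_in_def)
  then show "Poly_Mapping.lookup (kill_var y p) m = Poly_Mapping.lookup p m"
    by (cases "m \<in> Poly_Mapping.keys p") (simp_all add: lookup_kill_var not_in_keys_iff_lookup_eq_zero)
qed

lemma kill_var_const [simp]: "kill_var y (const_poly c) = const_poly c"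
  by (rule kill_var_id [OF polys_in_const [of _ "{}"]]) simp

lemma kill_var_sym:
  assumes "p \<in> sym_polys (insert y V)" "y \<notin> V"
  shows "kill_var y p \<in> sym_polys V"
  unfolding sym_polys_def
proof (intro CollectI conjI allI impI)
  show "kill_var y p \<in> polys_in V"
    unfolding polys_in_def
  proof (intro CollectI ballI)
    fix m assume "m \<in> Poly_Mapping.keys (kill_var y p)"
    then have "m \<in> Poly_Mapping.keys p" "y \<notin> Poly_Mapping.keys m"
      by (auto simp: lookup_kill_var in_keys_iff split: if_splits)
    then show "Poly_Mapping.keys m \<subseteq> V"
      using assms(1) unfolding sym_polys_def polys_in_def by blast
  qed
next
  fix \<pi> m assume \<pi>: "\<pi> permutes V"
  \<comment> \<open>Such a permutation keeps the exponent of \<open>y\<close>, so it respects the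
    test that \<open>kill_var\<close> makes.\<close>
  then have "\<pi> permutes insert y V" "\<pi> y = y"
    using assms(2) permutes_subset [OF \<pi>, of "insert y V"] by (auto simp: permutes_not_in)
  then show "Poly_Mapping.lookup (kill_var y p) (Poly_Mapping.map_key \<pi> m) = Poly_Mapping.lookup (kill_var y p) m"
    using assms(1) by (simp add: lookup_kill_var lookup_map_key [OF permutes_inj [OF \<pi>]] sym_polys_def)
qed

section \<open>Elementary symmetric polynomials and one additional variable\<close>

lemma esym_0: "finite V \<Longrightarrow> esym V 0 = 1"
proof -
  assume "finite V"
  then have "{I. I \<subseteq> V \<and> card I = 0} = {{}}"
    by (auto dest: finite_subset)
  then show ?thesis by (simp add: esym_def)
qed

lemma esym_eq_0: "finite V \<Longrightarrow> card V < k \<Longrightarrow> esym V k = 0"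
proof -
  assume "finite V" "card V < k"
  then have "{I. I \<subseteq> V \<and> card I = k} = {}"
    by (auto dest: card_mono)
  then show ?thesis by (simp only: esym_def sum.empty)
qed

lemma esym_card:
  assumes "finite V"
  shows "esym V (card V) = (\<Prod>v\<in>V. indet v)"
proof -
  have "{I. I \<subseteq> V \<and> card I = card V} = {V}"
    using assms by (auto dest: card_subset_eq)
  then show ?thesis by (simp add: esym_def)
qed

text \<open>The subsets are split by whether they contain \<open>y\<close>. The right-hand side is
  the shape of the values prescribed for \<open>\<Phi>\<close>, which are thereby elementary
  symmetric polynomials in one more variable.\<close>

lemma esym_insert_Suc:
  assumes "finite V" "y \<notin> V"
  shows "esym (insert y V) (Suc k) = esym V (Suc k) + esym V k * indet y"
proof -
  let ?S = "\<lambda>k. {I. I \<subseteq> V \<and> card I = k}"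
  have fin: "finite I" if "I \<subseteq> V" for I
    using that assms(1) by (rule finite_subset)
  have "{I. I \<subseteq> insert y V \<and> card I = Suc k} = ?S (Suc k) \<union> insert y ` ?S k" (is "?L = ?R")
  proof (intro equalityI subsetI)
    fix I assume I: "I \<in> ?L"
    show "I \<in> ?R"
    proof (cases "y \<in> I")
      case True
      then have "I = insert y (I - {y})" "I - {y} \<in> ?S k"
        using I by (auto simp: card_Diff_singleton)
      then show ?thesis by blast
    qed (use I in auto)
  next
    fix I assume "I \<in> ?R"
    then show "I \<in> ?L"
      using fin assms(2) by (auto simp: card_insert_if)
  qed
  moreover have "inj_on (insert y) (?S k)"
    using assms(2) by (intro inj_onI) (auto dest: insert_ident [THEN iffD1, rotated 2])
  moreover have "(\<Prod>v\<in>insert y I. indet v) = (\<Prod>v\<in>I. indet v) * indet y" if "I \<in> ?S k" for I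
    using that fin assms(2) by (subst prod.insert) (auto simp: mult.commute)
  moreover have "?S (Suc k) \<inter> insert y ` ?S k = {}"
    using assms(2) by auto
  moreover have "finite (?S j)" for j
    using assms(1) by simp
  ultimately show ?thesis
    by (simp add: esym_def sum.union_disjoint sum.reindex sum_distrib_right)
qed

text \<open>The summand that the recursion adds is a multiple of \<open>y\<close>. For
  \<open>k\<close> above \<open>card V\<close> the result is zero.\<close>

lemma kill_var_esym:
  assumes "finite V" "y \<notin> V"
  shows "kill_var y (esym (insert y V) k) = esym V k"
proof (cases k)
  case 0
  then show ?thesis
    using assms by (simp add: esym_0 kill_var_const [of y 1, simplified])
next
  case (Suc j)
  then show ?thesis
    using assms by (simp add: esym_insert_Suc kill_var_add kill_var_mult kill_var_id [OF polys_in_esym])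
qed

lemma prod_indet: "finite V \<Longrightarrow> (\<Prod>v\<in>V. indet v) = Poly_Mapping.single (\<Sum>v\<in>V. Poly_Mapping.single v 1) 1"
  by (induction V rule: finite_induct) (simp_all add: indet_def mult_single)

text \<open>The top elementary symmetric polynomial is one monomial, so the product has the
  coefficients of \<open>p\<close> at translated places.\<close>

lemma esym_top_cancel:
  assumes "finite V" "esym V (card V) * p = 0"
  shows "p = 0"
proof (rule poly_mapping_eqI)
  fix m
  show "Poly_Mapping.lookup p m = Poly_Mapping.lookup 0 m"
    using assms lookup_mult_single [of "\<Sum>v\<in>V. Poly_Mapping.single v 1" p m]
    by (simp add: esym_card prod_indet)
qed

section \<open>Generation by elementary symmetric polynomials\<close>

definition mono_degree :: "'v set \<Rightarrow> ('v \<Rightarrow>\<^sub>0 nat) \<Rightarrow> nat" where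
  "mono_degree V m = (\<Sum>v\<in>V. Poly_Mapping.lookup m v)"

lemma mono_degree_add: "mono_degree V (m + n) = mono_degree V m + mono_degree V n"
  by (simp add: mono_degree_def lookup_add sum.distrib)

lemma mono_degree_sum: "mono_degree V (sum f I) = (\<Sum>i\<in>I. mono_degree V (f i))"
  by (simp add: mono_degree_def lookup_sum sum.swap [of _ I])

lemma mono_degree_single: "finite V \<Longrightarrow> v \<in> V \<Longrightarrow> mono_degree V (Poly_Mapping.single v 1) = 1"
  by (simp add: mono_degree_def lookup_single when_def)

lemma mono_degree_esym:
  assumes "finite V" "m \<in> Poly_Mapping.keys (esym V k)"
  shows "mono_degree V m = k"
proof -
  obtain I where I: "I \<subseteq> V" "card I = k" "m \<in> Poly_Mapping.keys (\<Prod>v\<in>I. indet v)"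
    using assms(2) keys_sum [of "\<lambda>I. \<Prod>v\<in>I. indet v" "{I. I \<subseteq> V \<and> card I = k}"]
    unfolding esym_def by blast
  then have "m = (\<Sum>v\<in>I. Poly_Mapping.single v 1)"
    by (simp add: prod_indet [OF finite_subset [OF I(1) assms(1)]])
  then have "mono_degree V m = (\<Sum>v\<in>I. mono_degree V (Poly_Mapping.single v 1))"
    by (simp add: mono_degree_sum)
  also have "\<dots> = (\<Sum>v\<in>I. 1)"
    by (rule sum.cong) (use I(1) mono_degree_single [OF assms(1)] in auto)
  finally show ?thesis
    using I by simp
qed

text \<open>Vanishing at \<open>y = 0\<close> means that \<open>y\<close> divides every monomial of
  \<open>p\<close>. By symmetry every other variable does too, hence so does their product.\<close>

lemma sym_polys_divide_esym_top:
  assumes V: "finite V" "y \<in> V" and p: "p \<in> sym_polys V" and kill: "kill_var y p = 0"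
  shows "\<exists>q\<in>sym_polys V. p = esym V (card V) * q"
proof -
  define M where "M = (\<Sum>v\<in>V. Poly_Mapping.single v (1::nat))"
  \<comment> \<open>The quotient is read off from the coefficients of \<open>p\<close> at exponents
    raised by one in each variable.\<close>
  define q where "q = Poly_Mapping.map_key (\<lambda>m. M + m) p"
  have M: "Poly_Mapping.lookup M v = (if v \<in> V then 1 else 0)" for v
    using V(1) by (simp add: M_def lookup_sum lookup_single when_def)
  have inj: "inj (\<lambda>m. M + m)"
    by (auto intro: injI)
  have q: "Poly_Mapping.lookup q m = Poly_Mapping.lookup p (M + m)" for m
    by (simp add: q_def map_key.rep_eq inj)
  have pos: "0 < Poly_Mapping.lookup m v" if m: "m \<in> Poly_Mapping.keys p" and v: "v \<in> V" for m v
  proof -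
    \<comment> \<open>Exchanging \<open>y\<close> and \<open>v\<close> turns the exponent of
      \<open>v\<close> into that of \<open>y\<close>, which cannot be zero.\<close>
    let ?\<pi> = "transpose y v"
    have \<pi>: "?\<pi> permutes V"
      using V v by (simp add: permutes_swap_id)
    have "Poly_Mapping.map_key ?\<pi> m \<in> Poly_Mapping.keys p"
      using p \<pi> m by (simp add: sym_polys_def in_keys_iff)
    then have "Poly_Mapping.lookup (Poly_Mapping.map_key ?\<pi> m) y \<noteq> 0"
      using kill by (metis in_keys_iff lookup_kill_var lookup_zero)
    then show ?thesis
      by (simp add: lookup_map_key [OF permutes_inj [OF \<pi>]])
  qed
  have "p = Poly_Mapping.single M 1 * q"
  proof (rule poly_mapping_eqI)
    fix k
    show "Poly_Mapping.lookup p k = Poly_Mapping.lookup (Poly_Mapping.single M 1 * q) k"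
    proof (cases "\<exists>m. k = M + m")
      case True
      then show ?thesis
        by (auto simp: lookup_mult_single q)
    next
      case False
      \<comment> \<open>Subtraction of exponents is truncated; \<open>pos\<close> makes it exact on
        \<open>V\<close>, and \<open>M\<close> is zero elsewhere.\<close>
      have "k = M + (k - M)" if "k \<in> Poly_Mapping.keys p"
        by (rule poly_mapping_eqI) (use pos [OF that] in \<open>simp add: lookup_add lookup_minus M\<close>)
      then have "k \<notin> Poly_Mapping.keys p"
        using False by blast
      moreover have "k \<notin> Poly_Mapping.keys (Poly_Mapping.single M 1 * q)"
        using False keys_mult [of "Poly_Mapping.single M 1" q] by auto
      ultimately show ?thesis
        by (simp add: in_keys_iff)
    qed
  qed
  moreover have "q \<in> sym_polys V"
    unfolding sym_polys_def
  proof (intro CollectI conjI allI impI)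
    have sub: "Poly_Mapping.keys m \<subseteq> Poly_Mapping.keys (M + m)" for m
      by (auto simp: in_keys_iff lookup_add)
    have shift: "M + m \<in> Poly_Mapping.keys p" if "m \<in> Poly_Mapping.keys q" for m
      using that by (simp add: in_keys_iff q)
    have "p \<in> polys_in V"
      using p by (simp add: sym_polys_def)
    then show "q \<in> polys_in V"
      using sub shift unfolding polys_in_def by blast
  next
    fix \<pi> m assume \<pi>: "\<pi> permutes V"
    have "Poly_Mapping.map_key \<pi> M = M"
      by (rule poly_mapping_eqI) (simp add: lookup_map_key permutes_inj [OF \<pi>] M permutes_in_image [OF \<pi>])
    then have "M + Poly_Mapping.map_key \<pi> m = Poly_Mapping.map_key \<pi> (M + m)"
      by (simp add: map_key_plus permutes_inj [OF \<pi>])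
    then show "Poly_Mapping.lookup q (Poly_Mapping.map_key \<pi> m) = Poly_Mapping.lookup q m"
      using p \<pi> by (simp add: q sym_polys_def)
  qed
  ultimately show ?thesis
    using V(1) by (auto simp: esym_card prod_indet M_def)
qed

text \<open>
  Polynomials in the elementary symmetric polynomials, with \<open>esym V k\<close> given weight \<open>k\<close>. The weight
  bounds the degree, which lets the induction in \<open>sym_polys_esym_poly\<close> lift the value at
  \<open>y = 0\<close> to one more variable without raising the degree.
\<close>

inductive esym_poly :: "'v set \<Rightarrow> nat \<Rightarrow> 'v cpoly \<Rightarrow> bool" for V where
  const: "esym_poly V d (const_poly c)"
| add: "esym_poly V d p \<Longrightarrow> esym_poly V d q \<Longrightarrow> esym_poly V d (p + q)"
| mult: "k \<in> {1..card V} \<Longrightarrow> esym_poly V d p \<Longrightarrow> esym_poly V (k + d) (esym V k * p)"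

lemma esym_poly_sym: "esym_poly V d p \<Longrightarrow> p \<in> sym_polys V"
  by (induction rule: esym_poly.induct) (auto intro: sym_polys_add sym_polys_mult sym_polys_esym)

lemma esym_poly_degree:
  assumes "finite V" "esym_poly V d p" "m \<in> Poly_Mapping.keys p"
  shows "mono_degree V m \<le> d"
  using assms(2,3)
proof (induction arbitrary: m rule: esym_poly.induct)
  case (const d c)
  then have "m = 0"
    by (simp add: const_poly_def split: if_splits)
  then show ?case
    by (simp add: mono_degree_def)
next
  case (add d p q)
  then show ?case
    using keys_add [of p q] by blast
next
  case (mult k d p)
  then obtain a b where "a \<in> Poly_Mapping.keys (esym V k)" "b \<in> Poly_Mapping.keys p" "m = a + b"
    using keys_mult [of "esym V k" p] by blast
  then show ?case
    using mono_degree_esym [OF assms(1)] mult.IH [of b] by (simp add: mono_degree_add)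
qed

text \<open>The same expression in the elementary symmetric polynomials of the larger set is a lift;
  the indices stay admissible because the number of variables grows.\<close>

lemma esym_poly_lift:
  assumes "finite V" "y \<notin> V" "esym_poly V d p"
  shows "\<exists>q. esym_poly (insert y V) d q \<and> kill_var y q = p"
  using assms(3)
proof (induction rule: esym_poly.induct)
  case (const d c)
  show ?case
    by (rule exI [of _ "const_poly c"]) (simp add: esym_poly.const)
next
  case (add d p q)
  then obtain p' q' where "esym_poly (insert y V) d p'" "kill_var y p' = p"
      "esym_poly (insert y V) d q'" "kill_var y q' = q"
    by blast
  then show ?case
    by (intro exI [of _ "p' + q'"]) (simp add: kill_var_add esym_poly.add)
next
  case (mult k d p)
  then obtain q where "esym_poly (insert y V) d q" "kill_var y q = p"
    by blast
  then show ?case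
    using mult.hyps assms
    by (intro exI [of _ "esym (insert y V) k * q"])
      (auto simp: kill_var_mult kill_var_esym intro!: esym_poly.mult)
qed

text \<open>Induction on the number of variables, and inside it on the degree. The value at
  \<open>y = 0\<close> has fewer variables; lifting its expression and subtracting leaves a multiple
  of the product of all variables, with a cofactor of smaller degree.\<close>

lemma sym_polys_esym_poly:
  assumes "finite V" "p \<in> sym_polys V" "\<And>m. m \<in> Poly_Mapping.keys p \<Longrightarrow> mono_degree V m \<le> d"
  shows "esym_poly V d p"
  using assms
proof (induction V arbitrary: p d rule: finite_induct)
  case empty
  then have "m = 0" if "m \<in> Poly_Mapping.keys p" for m
    using that by (auto simp: sym_polys_def polys_in_def)
  then have "p = const_poly (Poly_Mapping.lookup p 0)"
    by (intro poly_mapping_eqI) (auto simp: const_poly_def lookup_single when_def in_keys_iff)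
  then show ?case
    using esym_poly.const by metis
next
  case (insert y V)
  let ?W = "insert y V"
  have W: "finite ?W" "y \<in> ?W"
    using insert.hyps by auto
  show ?case
    using insert.prems
  proof (induction d arbitrary: p rule: less_induct)
    case (less d)
    have "mono_degree V m \<le> d" if "m \<in> Poly_Mapping.keys (kill_var y p)" for m
    proof -
      have "m \<in> Poly_Mapping.keys p"
        using that by (auto simp: lookup_kill_var in_keys_iff split: if_splits)
      then show ?thesis
        using less.prems(2) [of m] insert.hyps by (simp add: mono_degree_def)
    qed
    then have "esym_poly V d (kill_var y p)"
      using insert.IH kill_var_sym [OF less.prems(1) insert.hyps(2)] by blast
    then obtain q where q: "esym_poly ?W d q" "kill_var y q = kill_var y p"
      using esym_poly_lift [OF insert.hyps(1,2)] by blast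
    obtain r where r: "r \<in> sym_polys ?W" "p - q = esym ?W (card ?W) * r"
      using sym_polys_divide_esym_top [OF W sym_polys_diff [OF less.prems(1) esym_poly_sym [OF q(1)]]]
        q(2) by (auto simp: kill_var_diff)
    \<comment> \<open>Translated by the product of the variables, a monomial of \<open>r\<close> is
      one of \<open>p - q\<close>. The weight bound on \<open>q\<close> is what keeps the degree of
      \<open>p - q\<close> at most \<open>d\<close>.\<close>
    have deg: "card ?W + mono_degree ?W m \<le> d" if "m \<in> Poly_Mapping.keys r" for m
    proof -
      let ?M = "\<Sum>v\<in>?W. Poly_Mapping.single v (1::nat)"
      have "Poly_Mapping.lookup (p - q) (?M + m) \<noteq> 0"
        unfolding r(2) esym_card [OF W(1)] prod_indet [OF W(1)] lookup_mult_single
        using that by (simp add: in_keys_iff)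
      then have "?M + m \<in> Poly_Mapping.keys p \<union> Poly_Mapping.keys q"
        by (auto simp: in_keys_iff lookup_minus)
      then have "mono_degree ?W (?M + m) \<le> d"
        using less.prems(2) esym_poly_degree [OF W(1) q(1)] by blast
      moreover have "mono_degree ?W ?M = (\<Sum>v\<in>?W. 1)"
        unfolding mono_degree_sum by (rule sum.cong) (use mono_degree_single [OF W(1)] in auto)
      ultimately show ?thesis
        by (simp add: mono_degree_add)
    qed
    have "esym_poly ?W d (p - q)"
    \<comment> \<open>Only a monomial of \<open>r\<close> gives \<open>card ?W \<le> d\<close>,
      without which \<open>d - card ?W\<close> would be truncated.\<close>
    proof (cases "r = 0")
      case True
      then show ?thesis
        using r(2) esym_poly.const [of ?W d 0] by simp
    next
      case False
      then obtain m where "m \<in> Poly_Mapping.keys r"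
        by (metis equals0I keys_eq_empty)
      then have le: "card ?W \<le> d"
        using deg by fastforce
      have pos: "1 \<le> card ?W"
        using W by (simp add: Suc_le_eq card_gt_0_iff)
      have "esym_poly ?W (d - card ?W) r"
      proof (rule less.IH)
        show "d - card ?W < d" using le pos by linarith
        show "mono_degree ?W m \<le> d - card ?W" if "m \<in> Poly_Mapping.keys r" for m
          using deg [OF that] by linarith
      qed (rule r(1))
      then show ?thesis
        using esym_poly.mult [of "card ?W" ?W "d - card ?W" r] pos le r(2) by simp
    qed
    then show ?case
      using esym_poly.add [OF _ q(1), of "p - q"] by simp
  qed
qed

text \<open>Generation in the form of an induction rule: the weights are forgotten, and products
  need only one generator at a time.\<close>

lemma sym_polys_induct [consumes 2, case_names const add mult]:
  assumes "finite V" "p \<in> sym_polys V"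
    and "\<And>c. P (const_poly c)"
    and "\<And>p q. p \<in> sym_polys V \<Longrightarrow> q \<in> sym_polys V \<Longrightarrow> P p \<Longrightarrow> P q \<Longrightarrow> P (p + q)"
    and "\<And>k p. k \<in> {1..card V} \<Longrightarrow> p \<in> sym_polys V \<Longrightarrow> P p \<Longrightarrow> P (esym V k * p)"
  shows "P p"
proof -
  have "mono_degree V m \<le> Max (mono_degree V ` Poly_Mapping.keys p)" if "m \<in> Poly_Mapping.keys p" for m
    using that by simp
  then have "esym_poly V (Max (mono_degree V ` Poly_Mapping.keys p)) p"
    using sym_polys_esym_poly assms(1,2) by blast
  then show ?thesis
  proof (induction rule: esym_poly.induct)
    case (const d c)
    show ?case by (rule assms(3))
  next
    case (add d p q)
    then show ?case using assms(4) esym_poly_sym by blast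
  next
    case (mult k d p)
    then show ?case using assms(5) esym_poly_sym by blast
  qed
qed

section \<open>The multiplication map on the tensor product\<close>

lemma poly_algebra_simps [simp]:
  "carrier (poly_algebra A) = A" "p \<otimes>\<^bsub>poly_algebra A\<^esub> q = p * q" "\<one>\<^bsub>poly_algebra A\<^esub> = 1"
  "\<zero>\<^bsub>poly_algebra A\<^esub> = 0" "p \<oplus>\<^bsub>poly_algebra A\<^esub> q = p + q"
  "c \<odot>\<^bsub>poly_algebra A\<^esub> p = const_poly c * p"
  by (simp_all add: poly_algebra_def)

section \<open>Subalgebras and adjunction of one element\<close>

definition poly_subalgebra :: "'v cpoly set \<Rightarrow> bool" where
  "poly_subalgebra A \<longleftrightarrow> (\<forall>c. const_poly c \<in> A) \<and> (\<forall>p\<in>A. \<forall>q\<in>A. p + q \<in> A \<and> p * q \<in> A)"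

lemma poly_subalgebraD:
  assumes "poly_subalgebra A"
  shows "const_poly c \<in> A" "0 \<in> A" "1 \<in> A"
    and "p \<in> A \<Longrightarrow> q \<in> A \<Longrightarrow> p + q \<in> A" "p \<in> A \<Longrightarrow> q \<in> A \<Longrightarrow> p * q \<in> A"
  using assms const_poly_0 const_poly_1 unfolding poly_subalgebra_def by metis+

lemma poly_subalgebra_sum:
  assumes "poly_subalgebra A" "\<And>i. i \<in> I \<Longrightarrow> f i \<in> A"
  shows "sum f I \<in> A"
  using assms(2)
  by (induction I rule: infinite_finite_induct) (auto simp: poly_subalgebraD [OF assms(1)])

lemma poly_subalgebra_power: "poly_subalgebra A \<Longrightarrow> p \<in> A \<Longrightarrow> p ^ i \<in> A"
  by (induction i) (auto simp: poly_subalgebraD)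

lemma poly_subalgebra_sym_polys: "poly_subalgebra (sym_polys V)"
  by (simp add: poly_subalgebra_def sym_polys_add sym_polys_mult)

lemma poly_subalgebra_generated: "poly_subalgebra (generated_algebra X)"
  by (auto simp: poly_subalgebra_def intro: generated_algebra.intros)

lemma poly_subalgebra_consts: "poly_subalgebra (range const_poly)"
  by (auto simp: poly_subalgebra_def simp flip: const_poly_add const_poly_mult)

lemma generated_algebra_subset: "X \<subseteq> A \<Longrightarrow> poly_subalgebra A \<Longrightarrow> generated_algebra X \<subseteq> A"
proof
  fix p assume "X \<subseteq> A" "poly_subalgebra A" "p \<in> generated_algebra X"
  then show "p \<in> A"
    by (induction rule: generated_algebra.induct[OF \<open>p \<in> _\<close>]) (auto simp: poly_subalgebraD)
qed

text \<open>This is \<open>A[e]\<close>. Univariate polynomials over the polynomial ring keep the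
  coefficients available for the uniqueness statement.\<close>

definition powers_span :: "'v cpoly set \<Rightarrow> 'v cpoly \<Rightarrow> 'v cpoly set" where
  "powers_span A e = {poly P e | P. \<forall>i. coeff P i \<in> A}"

lemma poly_subalgebra_powers_span:
  assumes "poly_subalgebra A"
  shows "poly_subalgebra (powers_span A e)"
proof -
  note A = poly_subalgebraD [OF assms]
  have "const_poly c \<in> powers_span A e" for c
    unfolding powers_span_def by (auto intro!: exI [of _ "[:const_poly c:]"] simp: coeff_pCons A split: nat.split)
  moreover have "p + q \<in> powers_span A e" "p * q \<in> powers_span A e"
    if pq: "p \<in> powers_span A e" "q \<in> powers_span A e" for p q
  proof -
    obtain P Q where P: "p = poly P e" "\<forall>i. coeff P i \<in> A" and Q: "q = poly Q e" "\<forall>i. coeff Q i \<in> A"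
      using pq unfolding powers_span_def by blast
    have "\<forall>i. coeff (P + Q) i \<in> A" "\<forall>i. coeff (P * Q) i \<in> A"
      using P Q by (auto simp: A coeff_mult intro!: poly_subalgebra_sum [OF assms])
    then show "p + q \<in> powers_span A e" "p * q \<in> powers_span A e"
      unfolding powers_span_def P(1) Q(1) poly_add [symmetric] poly_mult [symmetric] by blast+
  qed
  ultimately show ?thesis
    by (simp add: poly_subalgebra_def)
qed

lemma powers_span_base: "poly_subalgebra A \<Longrightarrow> e \<in> powers_span A e"
  unfolding powers_span_def
  by (auto intro!: exI [of _ "[:0, 1:]"] simp: coeff_pCons poly_subalgebraD split: nat.split)

lemma powers_span_coeff:
  assumes "poly_subalgebra A" "a \<in> A"
  shows "a \<in> powers_span A e"
  unfolding powers_span_def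
  using assms by (auto intro!: exI [of _ "[:a:]"] simp: coeff_pCons poly_subalgebraD split: nat.split)

section \<open>Bilinearity relations and the kernel of multiplication\<close>

lemma bilinear_relations_sum:
  "(\<And>i. i \<in> I \<Longrightarrow> f i \<in> bilinear_relations A B) \<Longrightarrow> sum f I \<in> bilinear_relations A B"
  by (induction I rule: infinite_finite_induct)
    (auto intro: bilinear_relations.zero bilinear_relations.plus)

lemma bilinear_relations_uminus:
  assumes "f \<in> bilinear_relations A B"
  shows "- f \<in> bilinear_relations A B"
proof -
  have "Poly_Mapping.map ((*) (-1)) f = - f"
    by (rule poly_mapping_eqI) simp
  then show ?thesis
    using bilinear_relations.scale [OF assms] by metis
qed

lemma bilinear_relations_diff:
  "f \<in> bilinear_relations A B \<Longrightarrow> g \<in> bilinear_relations A B \<Longrightarrow> f - g \<in> bilinear_relations A B"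
  using bilinear_relations.plus bilinear_relations_uminus by fastforce

lemma map_mult_diff: "Poly_Mapping.map ((*) c) (f - g) = Poly_Mapping.map ((*) c) f - Poly_Mapping.map ((*) c) g"
  for c :: complex
  by (rule poly_mapping_eqI) (simp add: lookup_minus algebra_simps)

lemma map_mult_sum: "Poly_Mapping.map ((*) c) (sum f I) = (\<Sum>i\<in>I. Poly_Mapping.map ((*) c) (f i))"
  for c :: complex
  by (rule poly_mapping_eqI) (simp add: lookup_sum sum_distrib_left)

lemma map_mult_single: "Poly_Mapping.map ((*) c) (Poly_Mapping.single k d) = Poly_Mapping.single k (c * d)"
  for c :: complex
  by (rule poly_mapping_eqI) (simp add: lookup_single when_def)

definition mult_map :: "('v cpoly \<times> 'v cpoly \<Rightarrow>\<^sub>0 complex) \<Rightarrow> 'v cpoly" where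
  "mult_map = lin_ext (\<lambda>(a, b). a * b)"

abbreviation pairs :: "'v cpoly set \<Rightarrow> 'v cpoly set \<Rightarrow> (complex, 'v cpoly \<times> 'v cpoly \<Rightarrow>\<^sub>0 complex) module" where
  "pairs A B \<equiv> pair_algebra (poly_algebra A) (poly_algebra B)"

abbreviation relations :: "'v cpoly set \<Rightarrow> 'v cpoly set \<Rightarrow> ('v cpoly \<times> 'v cpoly \<Rightarrow>\<^sub>0 complex) set" where
  "relations A B \<equiv> bilinear_relations (poly_algebra A) (poly_algebra B)"

context
  fixes A B :: "'v cpoly set"
  assumes A: "poly_subalgebra A" and B: "poly_subalgebra B"
begin

lemma mult_map_bilinear: "f \<in> relations A B \<Longrightarrow> mult_map f = 0"
  by (induction rule: bilinear_relations.induct)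
    (simp_all add: mult_map_def lin_ext_add lin_ext_diff lin_ext_scale algebra_simps)

lemma carrier_pairs: "carrier (pairs A B) = {f. Poly_Mapping.keys f \<subseteq> A \<times> B}"
  by (simp add: pair_algebra_def)

lemma carrier_add: "f \<in> carrier (pairs A B) \<Longrightarrow> g \<in> carrier (pairs A B) \<Longrightarrow> f + g \<in> carrier (pairs A B)"
  using keys_add [of f g] by (auto simp: carrier_pairs)

lemma carrier_diff: "f \<in> carrier (pairs A B) \<Longrightarrow> g \<in> carrier (pairs A B) \<Longrightarrow> f - g \<in> carrier (pairs A B)"
  using keys_diff [of f g] by (auto simp: carrier_pairs)

lemma carrier_scale: "f \<in> carrier (pairs A B) \<Longrightarrow> Poly_Mapping.map ((*) c) f \<in> carrier (pairs A B)"
  by (auto simp: carrier_pairs in_keys_iff)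

lemma carrier_single: "a \<in> A \<Longrightarrow> b \<in> B \<Longrightarrow> Poly_Mapping.single (a, b) c \<in> carrier (pairs A B)"
  by (simp add: carrier_pairs)

lemma carrier_sum: "(\<And>i. i \<in> J \<Longrightarrow> f i \<in> carrier (pairs A B)) \<Longrightarrow> sum f J \<in> carrier (pairs A B)"
proof (induction J rule: infinite_finite_induct)
  case (insert x F)
  then show ?case by (auto intro: carrier_add)
qed (simp_all add: carrier_pairs)

lemma bilinear_carrier: "f \<in> relations A B \<Longrightarrow> f \<in> carrier (pairs A B)"
proof (induction rule: bilinear_relations.induct)
  case zero
  then show ?case by (simp add: carrier_pairs)
qed (auto simp: poly_subalgebraD [OF A] poly_subalgebraD [OF B]
    intro!: carrier_add carrier_diff carrier_single carrier_scale)

lemma carrier_mult: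
  assumes "f \<in> carrier (pairs A B)" "g \<in> carrier (pairs A B)"
  shows "f \<otimes>\<^bsub>pairs A B\<^esub> g \<in> carrier (pairs A B)"
proof -
  have "(fst p * fst q, snd p * snd q) \<in> A \<times> B"
    if "p \<in> Poly_Mapping.keys f" "q \<in> Poly_Mapping.keys g" for p q
  proof -
    have "p \<in> A \<times> B" "q \<in> A \<times> B"
      using that assms by (auto simp: carrier_pairs)
    then show ?thesis
      by (auto simp: poly_subalgebraD [OF A] poly_subalgebraD [OF B])
  qed
  then have "(\<Sum>p\<in>Poly_Mapping.keys f. \<Sum>q\<in>Poly_Mapping.keys g.
      Poly_Mapping.single (fst p * fst q, snd p * snd q)
        (Poly_Mapping.lookup f p * Poly_Mapping.lookup g q)) \<in> carrier (pairs A B)"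
    by (intro carrier_sum) (simp add: carrier_pairs)
  then show ?thesis
    by (simp add: pair_algebra_def)
qed

lemma mult_map_mult: "mult_map (f \<otimes>\<^bsub>pairs A B\<^esub> g) = mult_map f * mult_map g"
  by (simp add: pair_algebra_def mult_map_def lin_ext_sum lin_ext_def [of _ f]
      lin_ext_def [of _ g] sum_product const_poly_mult case_prod_beta mult_ac)

text \<open>The isomorphism theorem with the inverse map made explicit: when the relations are the
  whole kernel, their cosets are the fibres of \<open>mult_map\<close>.\<close>

lemma direct_product_algebra_iso:
  assumes surj: "mult_map ` carrier (pairs A B) = S"
    and ker: "\<And>f. f \<in> carrier (pairs A B) \<Longrightarrow> mult_map f = 0 \<Longrightarrow> f \<in> relations A B"
  shows "(\<lambda>p. {f \<in> carrier (pairs A B). mult_map f = p}) \<in>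
    algebra_iso (poly_algebra S) (direct_product_algebra (poly_algebra A) (poly_algebra B))"
proof -
  let ?h = "\<lambda>p. {f \<in> carrier (pairs A B). mult_map f = p}"
  let ?D = "direct_product_algebra (poly_algebra A) (poly_algebra B)"
  have coset: "relations A B +>\<^bsub>pairs A B\<^esub> f = ?h (mult_map f)" if f: "f \<in> carrier (pairs A B)" for f
  proof (intro equalityI subsetI)
    fix g assume "g \<in> relations A B +>\<^bsub>pairs A B\<^esub> f"
    then obtain i where "i \<in> relations A B" "g = i + f"
      by (auto simp: a_r_coset_def' pair_algebra_def)
    then show "g \<in> ?h (mult_map f)"
      using f mult_map_bilinear by (auto simp: bilinear_carrier carrier_add mult_map_def lin_ext_add)
  next
    fix g assume "g \<in> ?h (mult_map f)"
    then have "g - f \<in> relations A B"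
      using f by (auto intro!: ker simp: carrier_diff mult_map_def lin_ext_diff)
    moreover have "g = (g - f) \<oplus>\<^bsub>pairs A B\<^esub> f"
      by (simp add: pair_algebra_def)
    ultimately show "g \<in> relations A B +>\<^bsub>pairs A B\<^esub> f"
      unfolding a_r_coset_def' by blast
  qed
  have ex: "\<exists>f. f \<in> ?h p" if "p \<in> S" for p
    using that surj by blast
  \<comment> \<open>Multiplication and scaling in the quotient are unions over representatives; over
    an empty fibre such a union would be empty instead of a coset.\<close>
  have ne: "?h p \<noteq> {}" if "p \<in> S" for p
    using ex [OF that] by blast
  have carr: "carrier ?D = ?h ` S"
    by (auto simp: direct_product_algebra_def ring.defs FactRing_def A_RCOSETS_def' coset surj [symmetric])
  have inj: "inj_on ?h S"
    using ex by (intro inj_onI) blast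
  have mult: "?h (p * q) = ?h p \<otimes>\<^bsub>?D\<^esub> ?h q" if "p \<in> S" "q \<in> S" for p q
  proof -
    have "?h p \<otimes>\<^bsub>?D\<^esub> ?h q = (\<Union>f\<in>?h p. \<Union>g\<in>?h q. ?h (p * q))"
      by (simp add: direct_product_algebra_def ring.defs FactRing_def rcoset_mult_def coset carrier_mult mult_map_mult)
    then show ?thesis
      by (simp only: UN_constant ne [OF that(1)] ne [OF that(2)] if_False)
  qed
  have add: "?h (p + q) = ?h p \<oplus>\<^bsub>?D\<^esub> ?h q" if "p \<in> S" "q \<in> S" for p q
  proof -
    have "?h p \<oplus>\<^bsub>?D\<^esub> ?h q = (\<Union>f\<in>?h p. \<Union>g\<in>?h q. {f + g})"
      by (simp add: direct_product_algebra_def ring.defs FactRing_def set_add_def' pair_algebra_def)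
    also have "\<dots> = ?h (p + q)"
    proof (intro equalityI subsetI)
      fix k assume k: "k \<in> ?h (p + q)"
      obtain f where f: "f \<in> ?h p"
        using ex [OF \<open>p \<in> S\<close>] by blast
      have "k - f \<in> ?h q" "k = f + (k - f)"
        using k f by (auto simp: carrier_diff mult_map_def lin_ext_diff)
      then show "k \<in> (\<Union>f\<in>?h p. \<Union>g\<in>?h q. {f + g})"
        using f by blast
    qed (auto simp: carrier_add mult_map_def lin_ext_add)
    finally show ?thesis ..
  qed
  have one: "?h 1 = \<one>\<^bsub>?D\<^esub>"
  proof -
    have "\<one>\<^bsub>pairs A B\<^esub> \<in> carrier (pairs A B)" "mult_map \<one>\<^bsub>pairs A B\<^esub> = 1"
      by (simp_all add: carrier_pairs pair_algebra_def mult_map_def poly_subalgebraD [OF A] poly_subalgebraD [OF B])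
    then show ?thesis
      by (simp add: direct_product_algebra_def ring.defs FactRing_def coset)
  qed
  have smult: "?h (const_poly c * p) = c \<odot>\<^bsub>?D\<^esub> ?h p" if "p \<in> S" for c p
  proof -
    have "c \<odot>\<^bsub>?D\<^esub> ?h p = (\<Union>f\<in>?h p. relations A B +>\<^bsub>pairs A B\<^esub> Poly_Mapping.map ((*) c) f)"
      by (simp add: direct_product_algebra_def ring.defs) (simp add: pair_algebra_def)
    also have "\<dots> = (\<Union>f\<in>?h p. ?h (const_poly c * p))"
      by (simp add: coset carrier_scale mult_map_def lin_ext_scale)
    finally show ?thesis
      by (simp only: UN_constant ne [OF that] if_False)
  qed
  have "?h \<in> ring_hom (poly_algebra S) ?D"
    unfolding ring_hom_def poly_algebra_simps carr using mult add one by blast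
  then show ?thesis
    unfolding algebra_iso_def algebra_hom_def bij_betw_def poly_algebra_simps carr
    using inj smult by blast
qed

end

section \<open>Polynomials in one element\<close>

text \<open>The normal form of a tensor. As the sum stops at \<open>degree P\<close>, it is additive
  only modulo relations, and for \<open>P = 0\<close> it is the basis element
  \<open>(0, 1)\<close>.\<close>

definition power_tensor :: "'v cpoly poly \<Rightarrow> 'v cpoly \<Rightarrow> 'v cpoly \<times> 'v cpoly \<Rightarrow>\<^sub>0 complex" where
  "power_tensor P e = (\<Sum>i\<le>degree P. Poly_Mapping.single (coeff P i, e ^ i) 1)"

lemma mult_map_power_tensor: "mult_map (power_tensor P e) = poly P e"
  by (simp add: mult_map_def power_tensor_def lin_ext_sum poly_altdef)

context
  fixes A :: "'v cpoly set" and e :: "'v cpoly"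
  assumes A: "poly_subalgebra A"
begin

abbreviation (input) "B \<equiv> generated_algebra {e}"

lemma power_in_B: "e ^ i \<in> B"
  by (intro poly_subalgebra_power poly_subalgebra_generated generated_algebra.base) simp

text \<open>A pair with a zero entry is a nonzero basis element of the free space; the scaling
  relation with scalar 0 makes it vanish in the quotient.\<close>

lemma zero_tensor:
  assumes "b \<in> B"
  shows "Poly_Mapping.single (0, b) 1 \<in> relations A B"
  using bilinear_relations.smult_left [of 0 "poly_algebra A" b "poly_algebra B" 0] assms
  by (simp add: poly_subalgebraD [OF A])

text \<open>Degrees can drop in sums and scalar multiples, so sums of different lengths have to be
  compared; the excess terms are zero tensors.\<close>

lemma power_tensor_pad:
  assumes "degree P \<le> n"
  shows "(\<Sum>i\<le>n. Poly_Mapping.single (coeff P i, e ^ i) 1) - power_tensor P e \<in> relations A B"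
proof -
  have "(\<Sum>i\<le>n. Poly_Mapping.single (coeff P i, e ^ i) (1::complex))
      = power_tensor P e + (\<Sum>i\<in>{..n} - {..degree P}. Poly_Mapping.single (coeff P i, e ^ i) 1)"
    unfolding power_tensor_def by (subst add.commute, rule sum.subset_diff) (use assms in auto)
  moreover have "(\<Sum>i\<in>{..n} - {..degree P}. Poly_Mapping.single (coeff P i, e ^ i) 1) \<in> relations A B"
    by (rule bilinear_relations_sum) (auto simp: coeff_eq_0 zero_tensor power_in_B)
  ultimately show ?thesis by simp
qed

lemma power_tensor_add:
  assumes P: "\<And>i. coeff P i \<in> A" and Q: "\<And>i. coeff Q i \<in> A"
  shows "power_tensor P e + power_tensor Q e - power_tensor (P + Q) e \<in> relations A B"
proof -
  define n where "n = max (degree P) (degree Q)"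
  define t where "t R = (\<Sum>i\<le>n. Poly_Mapping.single (coeff R i, e ^ i) (1::complex))" for R :: "'v cpoly poly"
  have pad: "t R - power_tensor R e \<in> relations A B" if "degree R \<le> n" for R
    unfolding t_def using that by (rule power_tensor_pad)
  have "t (P + Q) - t P - t Q = (\<Sum>i\<le>n. Poly_Mapping.single (coeff P i + coeff Q i, e ^ i) 1
      - Poly_Mapping.single (coeff P i, e ^ i) 1 - Poly_Mapping.single (coeff Q i, e ^ i) 1)"
    by (simp add: t_def sum_subtractf)
  also have "\<dots> \<in> relations A B"
    using P Q power_in_B bilinear_relations.add_left [of _ "poly_algebra A" _ _ "poly_algebra B"]
    by (intro bilinear_relations_sum) simp
  finally have 1: "t (P + Q) - t P - t Q \<in> relations A B" .
  \<comment> \<open>The padded sums \<open>t\<close> cancel, leaving the negated and the two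
    positive normal forms of the claim.\<close>
  have "(t (P + Q) - power_tensor (P + Q) e) - (t (P + Q) - t P - t Q)
      - (t P - power_tensor P e) - (t Q - power_tensor Q e) \<in> relations A B"
    by (intro bilinear_relations_diff 1 pad) (auto simp: n_def degree_add_le)
  then show ?thesis
    by (simp add: algebra_simps)
qed

lemma single_sum_right:
  assumes "a \<in> A" "\<And>i. i \<in> J \<Longrightarrow> b i \<in> B"
  shows "Poly_Mapping.single (a, sum b J) 1 - (\<Sum>i\<in>J. Poly_Mapping.single (a, b i) 1) \<in> relations A B"
  using assms(2)
proof (induction J rule: infinite_finite_induct)
  case (insert x F)
  have sumB: "sum b F \<in> B"
    using insert.prems by (intro poly_subalgebra_sum poly_subalgebra_generated) auto
  have "(Poly_Mapping.single (a, b x + sum b F) 1 - Poly_Mapping.single (a, b x) 1 - Poly_Mapping.single (a, sum b F) 1)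
      + (Poly_Mapping.single (a, sum b F) 1 - (\<Sum>i\<in>F. Poly_Mapping.single (a, b i) 1)) \<in> relations A B"
    using insert bilinear_relations.add_right [of a "poly_algebra A" "b x" "poly_algebra B" "sum b F"] assms(1) sumB
    by (intro bilinear_relations.plus) simp_all
  then show ?case
    using insert.hyps by (simp add: algebra_simps)
\<comment> \<open>A sum over an infinite set is 0, so the pair \<open>(a, 0)\<close> itself must be
  a relation, just as for the empty set.\<close>
next
  case (infinite F)
  have "0 \<in> B"
    using generated_algebra.const [of 0] by simp
  then show ?case
    using bilinear_relations.smult_right [of a "poly_algebra A" 0 "poly_algebra B" 0] assms(1) infinite by simp
next
  case empty
  have "0 \<in> B"
    using generated_algebra.const [of 0] by simp
  then show ?case
    using bilinear_relations.smult_right [of a "poly_algebra A" 0 "poly_algebra B" 0] assms(1) by simp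
qed

lemma generated_algebra_poly:
  assumes "b \<in> B"
  obtains Q where "b = poly Q e" "\<And>i. coeff Q i \<in> range const_poly"
proof -
  have "B \<subseteq> powers_span (range const_poly) e"
    by (intro generated_algebra_subset poly_subalgebra_powers_span poly_subalgebra_consts)
      (simp add: powers_span_base poly_subalgebra_consts)
  then show thesis
    using assms that unfolding powers_span_def by blast
qed

text \<open>Expand \<open>b\<close> in powers of \<open>e\<close> and move its scalar coefficients
  to the left entry; the normal form has coefficients \<open>a\<close> times those of
  \<open>b\<close>.\<close>

lemma single_eq_power_tensor:
  assumes a: "a \<in> A" and b: "b \<in> B"
  shows "\<exists>P. (\<forall>i. coeff P i \<in> A) \<and> Poly_Mapping.single (a, b) 1 - power_tensor P e \<in> relations A B"
proof -
  obtain Q where Q: "b = poly Q e" "\<And>i. coeff Q i \<in> range const_poly"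
    using generated_algebra_poly [OF b] by blast
  have "\<forall>i. \<exists>c. coeff Q i = const_poly c"
    using Q(2) by blast
  then obtain q where q: "coeff Q i = const_poly (q i)" for i
    by metis
  let ?n = "degree Q" and ?s = "\<lambda>p. Poly_Mapping.single p (1::complex)"
  have 1: "?s (a, b) - (\<Sum>i\<le>?n. ?s (a, const_poly (q i) * e ^ i)) \<in> relations A B"
    unfolding Q(1) poly_altdef q
    by (intro single_sum_right a poly_subalgebraD(5) poly_subalgebra_generated power_in_B generated_algebra.const)
  \<comment> \<open>Both pairs are congruent to the pair \<open>(a, e ^ i)\<close> with formal
    coefficient \<open>q i\<close>.\<close>
  have "?s (a, const_poly (q i) * e ^ i) - ?s (const_poly (q i) * a, e ^ i) \<in> relations A B" for i
    using a power_in_B [of i] bilinear_relations_diff [OF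
        bilinear_relations.smult_right [of a "poly_algebra A" "e ^ i" "poly_algebra B" "q i"]
        bilinear_relations.smult_left [of a "poly_algebra A" "e ^ i" "poly_algebra B" "q i"]]
    by simp
  then have 2: "(\<Sum>i\<le>?n. ?s (a, const_poly (q i) * e ^ i) - ?s (const_poly (q i) * a, e ^ i)) \<in> relations A B"
    by (rule bilinear_relations_sum)
  have 3: "(\<Sum>i\<le>?n. ?s (const_poly (q i) * a, e ^ i)) - power_tensor (smult a Q) e \<in> relations A B"
    using power_tensor_pad [OF degree_smult_le, of a Q] by (simp add: q mult.commute)
  have "?s (a, b) - power_tensor (smult a Q) e \<in> relations A B"
    using bilinear_relations.plus [OF bilinear_relations.plus [OF 1 2] 3] by (simp add: sum_subtractf)
  moreover have "\<forall>i. coeff (smult a Q) i \<in> A"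
    by (simp add: q a poly_subalgebraD [OF A])
  ultimately show ?thesis by blast
qed

text \<open>A formal coefficient of a pair differs from a scalar inside its left entry; the left
  scaling relation exchanges them.\<close>

lemma map_mult_power_tensor:
  assumes P: "\<And>i. coeff P i \<in> A"
  shows "Poly_Mapping.map ((*) c) (power_tensor P e) - power_tensor (smult (const_poly c) P) e \<in> relations A B"
proof -
  let ?n = "degree P"
  have "- (Poly_Mapping.single (const_poly c * coeff P i, e ^ i) 1 - Poly_Mapping.single (coeff P i, e ^ i) c) \<in> relations A B" for i
    using P power_in_B bilinear_relations.smult_left [of _ "poly_algebra A" _ "poly_algebra B" c]
    by (intro bilinear_relations_uminus) simp
  then have "(\<Sum>i\<le>?n. Poly_Mapping.single (coeff P i, e ^ i) c - Poly_Mapping.single (const_poly c * coeff P i, e ^ i) 1) \<in> relations A B"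
    by (intro bilinear_relations_sum) simp
  from bilinear_relations.plus [OF this power_tensor_pad [OF degree_smult_le, of "const_poly c" P]]
  show ?thesis
    by (simp add: sum_subtractf power_tensor_def [of P] map_mult_sum map_mult_single)
qed

lemma tensor_eq_power_tensor:
  assumes "f \<in> carrier (pairs A B)"
  shows "\<exists>P. (\<forall>i. coeff P i \<in> A) \<and> f - power_tensor P e \<in> relations A B"
proof -
  have keys: "Poly_Mapping.keys f \<subseteq> A \<times> B"
    using assms by (simp add: pair_algebra_def)
  have scale: "\<exists>P. (\<forall>i. coeff P i \<in> A) \<and> Poly_Mapping.single p c - power_tensor P e \<in> relations A B"
    if p: "p \<in> A \<times> B" for p c
  proof -
    obtain P where P: "\<And>i. coeff P i \<in> A" "Poly_Mapping.single p 1 - power_tensor P e \<in> relations A B"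
      using single_eq_power_tensor p by (cases p) blast
    have "Poly_Mapping.map ((*) c) (Poly_Mapping.single p 1 - power_tensor P e)
        + (Poly_Mapping.map ((*) c) (power_tensor P e) - power_tensor (smult (const_poly c) P) e) \<in> relations A B"
      by (intro bilinear_relations.plus bilinear_relations.scale P map_mult_power_tensor)
    then have "Poly_Mapping.single p c - power_tensor (smult (const_poly c) P) e \<in> relations A B"
      by (simp add: map_mult_diff map_mult_single)
    moreover have "\<forall>i. coeff (smult (const_poly c) P) i \<in> A"
      by (simp add: P poly_subalgebraD [OF A])
    ultimately show ?thesis by blast
  qed
  \<comment> \<open>The induction runs over sets of pairs with \<open>f\<close> fixed, so each
    coefficient stays the one in \<open>f\<close>.\<close>
  have "\<exists>P. (\<forall>i. coeff P i \<in> A) \<and>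
      (\<Sum>p\<in>K. Poly_Mapping.single p (Poly_Mapping.lookup f p)) - power_tensor P e \<in> relations A B"
    if "finite K" "K \<subseteq> A \<times> B" for K
    using that
  proof (induction K rule: finite_induct)
    case empty
    \<comment> \<open>This is the pair \<open>(0, 1)\<close>, which is a relation but not
      zero.\<close>
    have "power_tensor 0 e \<in> relations A B"
      using zero_tensor [OF power_in_B [of 0]] by (simp add: power_tensor_def)
    then show ?case
      by (intro exI [of _ 0]) (simp add: poly_subalgebraD [OF A] bilinear_relations_uminus)
  next
    case (insert p K)
    then obtain P where P: "\<And>i. coeff P i \<in> A"
        "(\<Sum>p\<in>K. Poly_Mapping.single p (Poly_Mapping.lookup f p)) - power_tensor P e \<in> relations A B"
      by auto
    obtain Q where Q: "\<And>i. coeff Q i \<in> A"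
        "Poly_Mapping.single p (Poly_Mapping.lookup f p) - power_tensor Q e \<in> relations A B"
      using scale insert.prems by blast
    have "(\<Sum>p\<in>insert p K. Poly_Mapping.single p (Poly_Mapping.lookup f p)) - power_tensor (P + Q) e \<in> relations A B"
      using bilinear_relations.plus [OF bilinear_relations.plus [OF P(2) Q(2)] power_tensor_add [OF P(1) Q(1)]] insert.hyps
      by (simp add: algebra_simps)
    moreover have "\<forall>i. coeff (P + Q) i \<in> A"
      by (simp add: P Q poly_subalgebraD [OF A])
    ultimately show ?case by blast
  qed
  from this [OF finite_keys keys] show ?thesis
    by (simp add: sum_single_eq)
qed

text \<open>On normal forms multiplication is evaluation at \<open>e\<close>, so independence of the
  powers of \<open>e\<close> leaves only the zero normal form.\<close>

lemma mult_map_kernel: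
  assumes indep: "\<And>P. (\<And>i. coeff P i \<in> A) \<Longrightarrow> poly P e = 0 \<Longrightarrow> P = 0"
    and f: "f \<in> carrier (pairs A B)" "mult_map f = 0"
  shows "f \<in> relations A B"
proof -
  obtain P where P: "\<And>i. coeff P i \<in> A" "f - power_tensor P e \<in> relations A B"
    using tensor_eq_power_tensor [OF f(1)] by blast
  have "mult_map (f - power_tensor P e) = 0"
    by (rule mult_map_bilinear [OF A poly_subalgebra_generated P(2)])
  then have "poly P e = 0"
    using f(2) mult_map_power_tensor [of P e] by (simp add: mult_map_def lin_ext_diff)
  then have "P = 0"
    using indep P(1) by blast
  then have "power_tensor P e \<in> relations A B"
    using zero_tensor [OF power_in_B [of 0]] by (simp add: power_tensor_def)
  then show ?thesis
    using bilinear_relations.plus [OF P(2)] by fastforce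
qed

lemma mult_map_image:
  "mult_map ` carrier (pairs A B) = powers_span A e"
proof (intro equalityI subsetI)
  fix p assume "p \<in> mult_map ` carrier (pairs A B)"
  then obtain f where f: "p = mult_map f" "f \<in> carrier (pairs A B)"
    by blast
  obtain P where P: "\<forall>i. coeff P i \<in> A" "f - power_tensor P e \<in> relations A B"
    using tensor_eq_power_tensor [OF f(2)] by blast
  have "mult_map (f - power_tensor P e) = 0"
    by (rule mult_map_bilinear [OF A poly_subalgebra_generated P(2)])
  then have "p = poly P e"
    using f(1) mult_map_power_tensor [of P e] by (simp add: mult_map_def lin_ext_diff)
  then show "p \<in> powers_span A e"
    using P(1) unfolding powers_span_def by blast
next
  fix p assume "p \<in> powers_span A e"
  then obtain P where P: "p = poly P e" "\<And>i. coeff P i \<in> A"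
    unfolding powers_span_def by blast
  have "power_tensor P e \<in> carrier (pairs A B)"
    unfolding power_tensor_def
    by (intro carrier_sum carrier_single A poly_subalgebra_generated P(2) power_in_B)
  then show "p \<in> mult_map ` carrier (pairs A B)"
    using mult_map_power_tensor [of P e] P(1) by (metis image_eqI)
qed

end

section \<open>Independence of the powers of \<open>e\<close> and the isomorphism\<close>

lemma powers_independent:
  assumes V: "finite V" "kill_var y (esym V (card V)) = 0"
    and A: "\<And>a. a \<in> A \<Longrightarrow> kill_var y a = 0 \<Longrightarrow> a = 0"
    and P: "\<And>i. coeff P i \<in> A" "poly P (esym V (card V)) = 0"
  shows "P = 0"
  using P
proof (induction P)
  case (pCons a P)
  have "a \<in> A" and coeffs: "coeff P i \<in> A" for i
    using pCons.prems(1) [of 0] pCons.prems(1) [of "Suc i"] by simp_all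
  have eq: "a + esym V (card V) * poly P (esym V (card V)) = 0"
    using pCons.prems(2) by simp
  have "kill_var y (a + esym V (card V) * poly P (esym V (card V))) = kill_var y a"
    using V(2) by (simp add: kill_var_add kill_var_mult)
  then have "a = 0"
    using A [OF \<open>a \<in> A\<close>] by (simp add: eq)
  then have "poly P (esym V (card V)) = 0"
    using eq esym_top_cancel [OF V(1)] by simp
  then show ?case
    using pCons.IH coeffs \<open>a = 0\<close> by simp
qed simp

theorem theorem3p5:
  fixes n0 :: nat and x :: "nat \<Rightarrow> 'v" and y :: 'v
    and \<Phi> :: "'v cpoly \<Rightarrow> 'v cpoly"
  assumes "inj_on x {1..n0}"
    and "y \<notin> x ` {1..n0}"
    and "\<Phi> \<in> algebra_mono (sym_algebra (x ` {1..n0})) (sym_algebra (insert y (x ` {1..n0})))"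
    and "\<And>k. k \<in> {1..n0} \<Longrightarrow>
           \<Phi> (esym (x ` {1..n0}) k) = esym (x ` {1..n0}) k + esym (x ` {1..n0}) (k - 1) * indet y"
  shows "\<exists>h. h \<in> algebra_iso (sym_algebra (insert y (x ` {1..n0})))
                  (direct_product_algebra
                     (poly_algebra (\<Phi> ` sym_polys (x ` {1..n0})))
                     (poly_algebra (generated_algebra {esym (x ` {1..n0}) n0 * esym {y} 1})))"
proof -
  define V where "V = x ` {1..n0}"
  define W where "W = insert y V"
  define A where "A = \<Phi> ` sym_polys V"
  define e where "e = esym V n0 * esym {y} 1"
  have V: "finite V" "y \<notin> V" "card V = n0"
    using assms(1,2) by (simp_all add: V_def card_image)
  have W: "finite W" "card W = Suc n0"
    using V by (simp_all add: W_def)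
  \<comment> \<open>In the recursion for index \<open>n0 + 1\<close> the first summand vanishes,
    having more factors than \<open>V\<close> has variables; this covers \<open>n0 = 0\<close> as
    well.\<close>
  have e: "e = esym W (card W)"
    using V esym_insert_Suc [of V y n0] esym_card [of "{y}"]
    by (simp add: e_def W W_def esym_eq_0)

  have \<Phi>_sym: "\<Phi> p \<in> sym_polys W"
    and \<Phi>_add: "\<Phi> (p + q) = \<Phi> p + \<Phi> q"
    and \<Phi>_mult: "\<Phi> (p * q) = \<Phi> p * \<Phi> q"
    and \<Phi>_1: "\<Phi> 1 = 1"
    and \<Phi>_scale: "\<Phi> (const_poly c * p) = const_poly c * \<Phi> p"
    if "p \<in> sym_polys V" "q \<in> sym_polys V" for p q c
    using assms(3) that
    by (auto simp: algebra_mono_def algebra_hom_def ring_hom_def sym_algebra_def V_def W_def)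
  have \<Phi>_const: "\<Phi> (const_poly c) = const_poly c" for c
    using \<Phi>_scale [of 1 1 c] \<Phi>_1 [of 1 1] by simp
  have \<Phi>_esym: "\<Phi> (esym V k) = esym W k" if "k \<in> {1..n0}" for k
    using assms(4) [OF that] esym_insert_Suc [OF V(1,2), of "k - 1"] that by (simp add: V_def W_def)

  \<comment> \<open>Both maps are linear and multiplicative, so it is enough that
    \<open>kill_var y\<close> takes \<open>esym W k\<close> back to \<open>esym V k\<close>.\<close>
  have kill_\<Phi>: "kill_var y (\<Phi> p) = p" if "p \<in> sym_polys V" for p
    using V(1) that
  proof (induction rule: sym_polys_induct)
    case (const c)
    then show ?case by (simp add: \<Phi>_const)
  next
    case (add p q)
    then show ?case by (simp add: \<Phi>_add kill_var_add)
  next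
    case (mult k p)
    then show ?case
      using V by (simp add: \<Phi>_mult sym_polys_esym \<Phi>_esym kill_var_mult kill_var_esym W_def)
  qed

  have A: "poly_subalgebra A"
    unfolding poly_subalgebra_def A_def
  proof (intro conjI allI ballI)
    show "const_poly c \<in> \<Phi> ` sym_polys V" for c
      using \<Phi>_const sym_polys_const by (metis image_eqI)
  next
    fix p q assume "p \<in> \<Phi> ` sym_polys V" "q \<in> \<Phi> ` sym_polys V"
    then show "p + q \<in> \<Phi> ` sym_polys V" "p * q \<in> \<Phi> ` sym_polys V"
      by (auto simp flip: \<Phi>_add \<Phi>_mult intro: sym_polys_add sym_polys_mult)
  qed

  have "powers_span A e = sym_polys W"
  proof (intro equalityI subsetI)
    fix p assume "p \<in> powers_span A e"
    then obtain P where P: "p = poly P e" "\<And>i. coeff P i \<in> A"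
      unfolding powers_span_def by blast
    have "A \<subseteq> sym_polys W"
      using \<Phi>_sym by (auto simp: A_def)
    then show "p \<in> sym_polys W"
      unfolding P(1) poly_altdef e using P(2)
      by (intro poly_subalgebra_sum poly_subalgebra_sym_polys sym_polys_mult sym_polys_power sym_polys_esym) auto
  next
    note span = poly_subalgebra_powers_span [OF A, of e]
    fix p assume "p \<in> sym_polys W"
    with W(1) show "p \<in> powers_span A e"
    proof (induction rule: sym_polys_induct)
      case (const c)
      then show ?case by (rule poly_subalgebraD [OF span])
    next
      case (add p q)
      then show ?case by (intro poly_subalgebraD [OF span])
    next
      case (mult k p)
      \<comment> \<open>\<open>W\<close> has one generator more than \<open>V\<close>: the top one
        is \<open>e\<close>, all others are values of \<open>\<Phi>\<close>.\<close>
      have "esym W k \<in> powers_span A e"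
      proof (cases "k = Suc n0")
        case True
        then show ?thesis
          using powers_span_base [OF A, of e] by (simp add: e W)
      next
        case False
        then have "esym W k = \<Phi> (esym V k)"
          using mult.hyps W by (intro \<Phi>_esym [symmetric]) auto
        then have "esym W k \<in> A"
          using sym_polys_esym unfolding A_def by blast
        then show ?thesis
          by (rule powers_span_coeff [OF A])
      qed
      then show ?case
        using mult.IH by (intro poly_subalgebraD [OF span])
    qed
  qed
  then have surj: "mult_map ` carrier (pairs A (generated_algebra {e}))
      = sym_polys W"
    by (simp add: mult_map_image [OF A])

  have "kill_var y e = 0"
    unfolding e W_def kill_var_esym [OF V(1,2)] using V W by (simp add: esym_eq_0 W_def)
  moreover have "a = 0" if "a \<in> A" "kill_var y a = 0" for a
  proof -
    obtain p where p: "a = \<Phi> p" "p \<in> sym_polys V"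
      using \<open>a \<in> A\<close> by (auto simp: A_def)
    \<comment> \<open>Zero is written as a constant because \<open>\<Phi>\<close> is known to fix
      constants.\<close>
    then have "p = const_poly 0"
      using kill_\<Phi> that(2) by simp
    then show ?thesis
      using p(1) \<Phi>_const [of 0] by simp
  qed
  ultimately have indep: "P = 0" if "\<And>i. coeff P i \<in> A" "poly P e = 0" for P
    using powers_independent [OF W(1), of y A P] that unfolding e by blast

  show ?thesis
    using direct_product_algebra_iso [OF A poly_subalgebra_generated surj mult_map_kernel [OF A indep]]
    unfolding A_def e_def W_def V_def sym_algebra_def by blast
qed

end
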